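(* Let $\epsilon\in\{1,-1\}$, let $g_0$ be a constant real symmetric invertible $2\times2$ matrix, and let $\phi=\phi(x^1,x^2)$ be a smooth real function on an open set $U\subseteq\mathbb{R}^2$ with $\rho>0$ on $U$, whose graph $S_0$ is minimal, i.e. $h^{\mu\nu}\phi_{,\mu\nu}=0$. Let $g=h/\sqrt{\rho}$ and let $R$ be the Ricci scalar of the two-dimensional metric $g$. Then $$R=-\frac14\,g^{\alpha\beta}\,\mathrm{tr}\left[(\partial_\alpha g^{-1})\,(\partial_\beta g)\right],$$ where inside the trace $g$ is the $2\times2$ matrix $(g_{\alpha\beta})$, $g^{-1}$ is its inverse matrix, and $\mathrm{tr}$ is the standard matrix trace.
   Context: Greek indices run over $1,2$, repeated indices are summed, commas denote partial derivatives with respect to $x^1,x^2$, and $g_0^{\mu\nu}$ are the entries of $g_0^{-1}$. The graph $S_0=\{x^3=\phi(x^1,x^2)\}$ lies in the flat manifold $M_3$ with metric $g_{0\,\mu\nu}dx^\mu dx^\nu+\epsilon(dx^3)^2$; its induced metric is $h_{\mu\nu}=g_{0\,\mu\nu}+\epsilon\,\phi_{,\mu}\phi_{,\nu}$, with inverse $h^{\mu\nu}$. Put $\rho=1+\epsilon\,g_0^{\mu\nu}\phi_{,\mu}\phi_{,\nu}$, so $\det h=\rho\det g_0$. The mean curvature is $H=\rho^{-1/2}h^{\mu\nu}\phi_{,\mu\nu}$ and minimal means $H=0$. The conformal metric is $g_{\alpha\beta}=h_{\alpha\beta}/\sqrt{\rho}$, with inverse components $g^{\alpha\beta}$ and $\det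 g=\det g_0$. Curvature sign convention: the Ricci scalar of the round unit 2-sphere is $+2$. *)

theory Defs
  imports "HOL-Analysis.Analysis"
begin

section \<open>Partial derivatives and smooth functions\<close>

definition pd :: "'n::finite \<Rightarrow> (real^'n \<Rightarrow> real) \<Rightarrow> real^'n \<Rightarrow> real" where
  "pd i f x = deriv (\<lambda>t. f (x + t *\<^sub>R axis i 1)) 0"

text \<open>Entrywise partial derivative of a matrix field.\<close>

definition pd_mat :: "'n::finite \<Rightarrow> (real^'n \<Rightarrow> real^'m^'k) \<Rightarrow> real^'n \<Rightarrow> real^'m^'k" where
  "pd_mat i A x = (\<chi> a b. pd i (\<lambda>y. A y $ a $ b) x)"

text \<open>\<open>k\<close>-fold differentiability, and smoothness as differentiability of every order. These are
  meant for open sets.\<close>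

fun higher_differentiable_on ::
  "'a::real_normed_vector set \<Rightarrow> ('a \<Rightarrow> 'b::real_normed_vector) \<Rightarrow> nat \<Rightarrow> bool" where
  "higher_differentiable_on S f 0 \<longleftrightarrow> continuous_on S f"
| "higher_differentiable_on S f (Suc k) \<longleftrightarrow>
     (\<forall>x\<in>S. f differentiable (at x)) \<and>
     (\<forall>v. higher_differentiable_on S (\<lambda>x. frechet_derivative f (at x) v) k)"

definition smooth_on ::
  "'a::real_normed_vector set \<Rightarrow> ('a \<Rightarrow> 'b::real_normed_vector) \<Rightarrow> bool" where
  "smooth_on S f \<longleftrightarrow> (\<forall>k. higher_differentiable_on S f k)"

section \<open>Curvature of a metric given in coordinates\<close>

text \<open>A (pseudo-Riemannian) metric is given by its component matrix as a function of the
  coordinates. In \<open>christoffel g l m n\<close> the upper index is \<open>l\<close>; in \<open>riemann g r s m n\<close> the upper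
  index is \<open>r\<close>. The signs are such that the round unit 2-sphere has scalar curvature \<open>+2\<close>.\<close>

definition christoffel ::
  "(real^'n \<Rightarrow> real^'n^'n) \<Rightarrow> 'n::finite \<Rightarrow> 'n \<Rightarrow> 'n \<Rightarrow> real^'n \<Rightarrow> real" where
  "christoffel g l m n x =
     1/2 * (\<Sum>s\<in>UNIV. matrix_inv (g x) $ l $ s *
       (pd m (\<lambda>y. g y $ s $ n) x + pd n (\<lambda>y. g y $ s $ m) x - pd s (\<lambda>y. g y $ m $ n) x))"

definition riemann ::
  "(real^'n \<Rightarrow> real^'n^'n) \<Rightarrow> 'n::finite \<Rightarrow> 'n \<Rightarrow> 'n \<Rightarrow> 'n \<Rightarrow> real^'n \<Rightarrow> real" where
  "riemann g r s m n x =
     pd m (christoffel g r n s) x - pd n (christoffel g r m s) x +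
     (\<Sum>l\<in>UNIV. christoffel g r m l x * christoffel g l n s x
               - christoffel g r n l x * christoffel g l m s x)"

definition ricci ::
  "(real^'n \<Rightarrow> real^'n^'n) \<Rightarrow> 'n::finite \<Rightarrow> 'n \<Rightarrow> real^'n \<Rightarrow> real" where
  "ricci g s n x = (\<Sum>r\<in>UNIV. riemann g r s r n x)"

definition ricci_scalar :: "(real^'n \<Rightarrow> real^'n^'n) \<Rightarrow> real^'n::finite \<Rightarrow> real" where
  "ricci_scalar g x = (\<Sum>s\<in>UNIV. \<Sum>n\<in>UNIV. matrix_inv (g x) $ s $ n * ricci g s n x)"

section \<open>Graphs in a flat three-dimensional manifold\<close>

text \<open>The ambient metric is \<open>g\<^sub>0\<^sub>\<mu>\<^sub>\<nu> dx\<^sup>\<mu> dx\<^sup>\<nu> + \<epsilon> (dx\<^sup>3)\<^sup>2\<close> with constant \<open>g\<^sub>0\<close>, and the graph is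
  \<open>x\<^sup>3 = \<phi>(x\<^sup>1, x\<^sup>2)\<close>; \<open>x\<^sup>1, x\<^sup>2\<close> serve as coordinates on it.\<close>

definition induced_metric :: "real \<Rightarrow> real^2^2 \<Rightarrow> (real^2 \<Rightarrow> real) \<Rightarrow> real^2 \<Rightarrow> real^2^2" where
  "induced_metric \<epsilon> g0 \<phi> x = (\<chi> \<mu> \<nu>. g0 $ \<mu> $ \<nu> + \<epsilon> * pd \<mu> \<phi> x * pd \<nu> \<phi> x)"

definition rho :: "real \<Rightarrow> real^2^2 \<Rightarrow> (real^2 \<Rightarrow> real) \<Rightarrow> real^2 \<Rightarrow> real" where
  "rho \<epsilon> g0 \<phi> x =
     1 + \<epsilon> * (\<Sum>\<mu>\<in>UNIV. \<Sum>\<nu>\<in>UNIV. matrix_inv g0 $ \<mu> $ \<nu> * pd \<mu> \<phi> x * pd \<nu> \<phi> x)"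

definition mean_curvature :: "real \<Rightarrow> real^2^2 \<Rightarrow> (real^2 \<Rightarrow> real) \<Rightarrow> real^2 \<Rightarrow> real" where
  "mean_curvature \<epsilon> g0 \<phi> x =
     1 / sqrt (rho \<epsilon> g0 \<phi> x) *
     (\<Sum>\<mu>\<in>UNIV. \<Sum>\<nu>\<in>UNIV. matrix_inv (induced_metric \<epsilon> g0 \<phi> x) $ \<mu> $ \<nu> * pd \<nu> (pd \<mu> \<phi>) x)"

definition minimal_graph_on :: "(real^2) set \<Rightarrow> real \<Rightarrow> real^2^2 \<Rightarrow> (real^2 \<Rightarrow> real) \<Rightarrow> bool" where
  "minimal_graph_on U \<epsilon> g0 \<phi> \<longleftrightarrow> (\<forall>x\<in>U. mean_curvature \<epsilon> g0 \<phi> x = 0)"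

definition conformal_metric :: "real \<Rightarrow> real^2^2 \<Rightarrow> (real^2 \<Rightarrow> real) \<Rightarrow> real^2 \<Rightarrow> real^2^2" where
  "conformal_metric \<epsilon> g0 \<phi> x = (1 / sqrt (rho \<epsilon> g0 \<phi> x)) *\<^sub>R induced_metric \<epsilon> g0 \<phi> x"

end

theory Submission
  imports Defs
begin

text \<open>
  The minimal surface equation says that \<open>x\<^sup>1, x\<^sup>2\<close> are harmonic coordinates on the graph, that is,
  \<open>\<partial>\<^sub>\<mu> g\<^sup>\<mu>\<^sup>\<nu> = 0\<close> for the conformal metric \<open>g\<close>. Since \<open>det g = det g\<^sub>0\<close> is constant and the dimension
  is two, the entries of \<open>g\<^sup>-\<^sup>1\<close> are, up to sign, order and a constant factor, those of \<open>g\<close>, and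
  the divergence equation turns into the Codazzi equation \<open>\<partial>\<^sub>c g\<^sub>a\<^sub>b = \<partial>\<^sub>a g\<^sub>c\<^sub>b\<close>. In other words, \<open>g\<close> is
  locally the Hessian of a solution of a Monge-Ampere equation with constant right-hand side. The
  Codazzi equation is verified directly, as a pair of polynomial identities in the first and second
  derivatives of \<open>\<phi>\<close>, in \<open>minimal_graph_codazzi_identities\<close>.

  The formula for the curvature is then a fact about any metric, in any dimension, whose first
  derivatives \<open>T\<^sub>c\<^sub>a\<^sub>b = \<partial>\<^sub>c g\<^sub>a\<^sub>b\<close> form a totally symmetric and trace-free tensor. The second
  derivatives of \<open>g\<close> cancel, and both sides are equal to \<open>|T|\<^sup>2 / 4\<close>; this is
  \<open>ricci_scalar_hessian_metric\<close>. The trace of \<open>T\<close> is the logarithmic derivative of \<open>det g\<close>, which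
  is how the constant determinant enters.

  On the analytic side, the symmetry \<open>\<phi>\<^sub>,\<^sub>\<mu>\<^sub>\<nu> = \<phi>\<^sub>,\<^sub>\<nu>\<^sub>\<mu>\<close> (\<open>pd_commute\<close>) is derived from the
  symmetry of second difference quotients.
\<close>

section \<open>Calculus of partial derivatives\<close>

lemma DERIV_along_axis:
  assumes "f differentiable (at x)"
  shows "((\<lambda>t. f (x + t *\<^sub>R axis i 1)) has_real_derivative
    frechet_derivative f (at x) (axis i 1)) (at 0)"
proof -
  have "(f has_derivative frechet_derivative f (at x)) (at (x + 0 *\<^sub>R axis i 1))"
    using assms by (simp flip: frechet_derivative_works)
  then have "((\<lambda>t. f (x + t *\<^sub>R axis i 1)) has_derivative
      (\<lambda>t. frechet_derivative f (at x) (t *\<^sub>R axis i 1))) (at 0)"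
    by (rule has_derivative_compose[rotated]) (auto intro!: derivative_eq_intros)
  moreover have "(\<lambda>t. frechet_derivative f (at x) (t *\<^sub>R axis i 1))
      = (*) (frechet_derivative f (at x) (axis i 1))"
    using linear_frechet_derivative[OF assms] by (auto simp: linear_cmul)
  ultimately show ?thesis
    by (simp add: has_field_derivative_def)
qed

lemma pd_eqI:
  "((\<lambda>t. f (x + t *\<^sub>R axis i 1)) has_real_derivative D) (at 0) \<Longrightarrow> pd i f x = D"
  unfolding pd_def by (rule DERIV_imp_deriv)

lemma pd_frechet:
  "f differentiable (at x) \<Longrightarrow> pd i f x = frechet_derivative f (at x) (axis i 1)"
  by (rule pd_eqI[OF DERIV_along_axis])

lemma DERIV_pd:
  "f differentiable (at x) \<Longrightarrow> ((\<lambda>t. f (x + t *\<^sub>R axis i 1)) has_real_derivative pd i f x) (at 0)"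
  using DERIV_along_axis[of f x i] by (simp add: pd_frechet)

lemma pd_const [simp]: "pd i (\<lambda>y. c) x = 0"
  by (rule pd_eqI) auto

lemma pd_add:
  assumes "f differentiable (at x)" "g differentiable (at x)"
  shows "pd i (\<lambda>y. f y + g y) x = pd i f x + pd i g x"
  by (intro pd_eqI DERIV_add DERIV_pd assms)

lemma pd_mult:
  assumes "f differentiable (at x)" "g differentiable (at x)"
  shows "pd i (\<lambda>y. f y * g y) x = pd i f x * g x + f x * pd i g x"
  using DERIV_mult[OF assms[THEN DERIV_pd]]
  by (intro pd_eqI) (simp add: algebra_simps)

lemma pd_sum:
  assumes "\<And>a. a \<in> A \<Longrightarrow> f a differentiable (at x)"
  shows "pd i (\<lambda>y. \<Sum>a\<in>A. f a y) x = (\<Sum>a\<in>A. pd i (f a) x)"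
  by (intro pd_eqI DERIV_sum DERIV_pd assms)

lemma pd_cong_open:
  assumes "open U" "x \<in> U" "\<And>y. y \<in> U \<Longrightarrow> f y = g y"
  shows "pd i f x = pd i g x"
proof -
  have "((\<lambda>t. x + t *\<^sub>R axis i 1) \<longlongrightarrow> x + 0 *\<^sub>R axis i 1) (nhds 0)"
    by (intro tendsto_intros filterlim_ident)
  then have "\<forall>\<^sub>F t in nhds 0. x + t *\<^sub>R axis i 1 \<in> U"
    using topological_tendstoD assms(1,2) by fastforce
  then have "\<forall>\<^sub>F t in nhds 0. f (x + t *\<^sub>R axis i 1) = g (x + t *\<^sub>R axis i 1)"
    by (rule eventually_mono) (rule assms(3))
  then show ?thesis
    unfolding pd_def by (rule deriv_cong_ev) simp
qed

lemma differentiable_cong_open: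
  fixes f :: "'a::real_normed_vector \<Rightarrow> 'b::real_normed_vector"
  assumes "f differentiable (at x)" "open U" "x \<in> U" "\<And>y. y \<in> U \<Longrightarrow> f y = g y"
  shows "g differentiable (at x)"
  using assms has_derivative_transform_within_open unfolding differentiable_def by blast

lemma DERIV_inverse_sqrt:
  fixes u :: real
  assumes "u > 0"
  shows "((\<lambda>u. 1 / sqrt u) has_real_derivative - (1/2) * (1 / sqrt u) ^ 3) (at u)"
  using assms by (auto intro!: derivative_eq_intros simp: field_simps power3_eq_cube)

lemma differentiable_inverse_sqrt:
  assumes "f differentiable (at x)" "f x > 0"
  shows "(\<lambda>y. 1 / sqrt (f y)) differentiable (at x)"
proof -
  have "(\<lambda>u. 1 / sqrt u) differentiable (at (f x))"
    using DERIV_inverse_sqrt[OF assms(2)] real_differentiable_def by blast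
  from differentiable_compose[OF this assms(1)] show ?thesis .
qed

text \<open>The factor is written as the cube of \<^term>\<open>1 / sqrt (f x)\<close>, so that the derivative is
  visibly again a polynomial in differentiable functions.\<close>

lemma pd_inverse_sqrt:
  assumes "f differentiable (at x)" "f x > 0"
  shows "pd i (\<lambda>y. 1 / sqrt (f y)) x = - (1/2) * (1 / sqrt (f x)) ^ 3 * pd i f x"
proof (rule pd_eqI)
  have "((\<lambda>u. 1 / sqrt u) has_real_derivative - (1/2) * (1 / sqrt (f x)) ^ 3)
      (at (f (x + 0 *\<^sub>R axis i 1)))"
    using DERIV_inverse_sqrt[OF assms(2)] by simp
  from DERIV_chain2[OF this DERIV_pd[OF assms(1)]]
  show "((\<lambda>t. 1 / sqrt (f (x + t *\<^sub>R axis i 1))) has_real_derivative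
      - (1/2) * (1 / sqrt (f x)) ^ 3 * pd i f x) (at 0)" .
qed

section \<open>Symmetry of second derivatives and smoothness of partial derivatives\<close>

text \<open>The mean value theorem is applied in direction \<^term>\<open>i\<close> to the first difference of
  \<^term>\<open>f\<close> in direction \<^term>\<open>j\<close>.\<close>

lemma second_difference_mean_value:
  fixes f :: "real^'n \<Rightarrow> real"
  assumes "h > 0"
    and df: "\<And>s t. 0 \<le> s \<Longrightarrow> s \<le> h \<Longrightarrow> 0 \<le> t \<Longrightarrow> t \<le> h \<Longrightarrow>
      f differentiable (at (x + s *\<^sub>R axis i 1 + t *\<^sub>R axis j 1))"
  obtains s where "0 < s" "s < h"
    "f (x + h *\<^sub>R axis i 1 + h *\<^sub>R axis j 1) - f (x + h *\<^sub>R axis i 1) - f (x + h *\<^sub>R axis j 1) + f x =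
     h * (pd i f (x + s *\<^sub>R axis i 1 + h *\<^sub>R axis j 1) - pd i f (x + s *\<^sub>R axis i 1))"
proof -
  have D: "((\<lambda>s. f (x + s *\<^sub>R axis i 1 + t *\<^sub>R axis j 1)) has_real_derivative
      pd i f (x + s *\<^sub>R axis i 1 + t *\<^sub>R axis j 1)) (at s)"
    if "0 \<le> s" "s \<le> h" "0 \<le> t" "t \<le> h" for s t
  proof -
    let ?y = "x + s *\<^sub>R axis i 1 + t *\<^sub>R axis j 1"
    have "((\<lambda>u. f (?y + u *\<^sub>R axis i 1)) has_real_derivative pd i f ?y) (at (s + - s))"
      using DERIV_pd[OF df[OF that], of i] by simp
    then have "((\<lambda>u. f (?y + (u + - s) *\<^sub>R axis i 1)) has_real_derivative pd i f ?y) (at s)"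
      by (subst (asm) DERIV_shift) simp
    moreover have "?y + (u + - s) *\<^sub>R axis i 1 = x + u *\<^sub>R axis i 1 + t *\<^sub>R axis j 1" for u
      by (simp add: algebra_simps)
    ultimately show ?thesis by (simp only:)
  qed
  let ?F = "\<lambda>s. f (x + s *\<^sub>R axis i 1 + h *\<^sub>R axis j 1) - f (x + s *\<^sub>R axis i 1 + 0 *\<^sub>R axis j 1)"
  let ?F' = "\<lambda>s. pd i f (x + s *\<^sub>R axis i 1 + h *\<^sub>R axis j 1) - pd i f (x + s *\<^sub>R axis i 1 + 0 *\<^sub>R axis j 1)"
  have "\<exists>s>0. s < h \<and> ?F h - ?F 0 = (h - 0) * ?F' s"
    using \<open>h > 0\<close> by (intro MVT2 DERIV_diff D) auto
  then show ?thesis using that by auto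
qed

text \<open>The linear approximation of \<^term>\<open>pd i f\<close> at \<^term>\<open>x\<close> turns the difference of
  \<^term>\<open>pd i f\<close> from the mean value theorem into \<^term>\<open>h * pd j (pd i f) x\<close> up to an error
  \<open>o(h)\<close>.\<close>

lemma second_difference_tendsto:
  fixes f :: "real^'n \<Rightarrow> real"
  assumes "open U" "x \<in> U" and df: "\<And>y. y \<in> U \<Longrightarrow> f differentiable (at y)"
    and dp: "pd i f differentiable (at x)"
  shows "((\<lambda>h. (f (x + h *\<^sub>R axis i 1 + h *\<^sub>R axis j 1) - f (x + h *\<^sub>R axis i 1)
      - f (x + h *\<^sub>R axis j 1) + f x) / h\<^sup>2) \<longlongrightarrow> pd j (pd i f) x) (at_right 0)"
proof (rule tendstoI)
  fix e :: real assume "e > 0"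
  let ?L = "frechet_derivative (pd i f) (at x)"
  have L: "(pd i f has_derivative ?L) (at x)"
    using dp by (simp flip: frechet_derivative_works)
  then have lin: "linear ?L"
    by (rule has_derivative_linear)
  \<comment> \<open>The points used lie at distance at most \<open>s + h\<close> and \<open>s\<close> from \<^term>\<open>x\<close>, where \<open>s < h\<close>. The errors
     thus add up to less than \<open>3 h\<close> times the tolerance, and a quarter of \<^term>\<open>e\<close> suffices.\<close>
  obtain d where "d > 0" and d: "\<And>y. norm (y - x) < d \<Longrightarrow>
      \<bar>pd i f y - pd i f x - ?L (y - x)\<bar> \<le> (e / 4) * norm (y - x)"
    using L \<open>e > 0\<close> unfolding has_derivative_at_alt by (metis divide_pos_pos real_norm_def zero_less_numeral)
  obtain r where "r > 0" and r: "ball x r \<subseteq> U"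
    using assms(1,2) openE by blast
  show "\<forall>\<^sub>F h in at_right 0. dist ((f (x + h *\<^sub>R axis i 1 + h *\<^sub>R axis j 1) - f (x + h *\<^sub>R axis i 1)
      - f (x + h *\<^sub>R axis j 1) + f x) / h\<^sup>2) (pd j (pd i f) x) < e"
    unfolding eventually_at_right_field
  proof (intro exI[of _ "min d r / 2"] conjI allI impI)
    show "min d r / 2 > 0"
      using \<open>d > 0\<close> \<open>r > 0\<close> by simp
    fix h assume "0 < h" and h: "h < min d r / 2"
    have bound: "norm (s *\<^sub>R axis i 1 + t *\<^sub>R axis j 1 :: real^'n) \<le> s + t" if "0 \<le> s" "0 \<le> t" for s t
      using that norm_triangle_ineq[of "s *\<^sub>R axis i 1 :: real^'n" "t *\<^sub>R axis j 1"] by simp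
    have "f differentiable (at (x + s *\<^sub>R axis i 1 + t *\<^sub>R axis j 1))"
      if "0 \<le> s" "s \<le> h" "0 \<le> t" "t \<le> h" for s t
    proof (rule df, rule subsetD[OF r])
      have "dist (x + (s *\<^sub>R axis i 1 + t *\<^sub>R axis j 1)) x \<le> s + t"
        using bound that by (simp add: dist_norm)
      then show "x + s *\<^sub>R axis i 1 + t *\<^sub>R axis j 1 \<in> ball x r"
        using that h by (simp add: add.assoc dist_commute)
    qed
    then obtain s where "0 < s" "s < h" and s:
      "f (x + h *\<^sub>R axis i 1 + h *\<^sub>R axis j 1) - f (x + h *\<^sub>R axis i 1) - f (x + h *\<^sub>R axis j 1) + f x =
       h * (pd i f (x + s *\<^sub>R axis i 1 + h *\<^sub>R axis j 1) - pd i f (x + s *\<^sub>R axis i 1))"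
      using second_difference_mean_value[OF \<open>0 < h\<close>] by blast
    define u where "u = s *\<^sub>R axis i 1 + h *\<^sub>R (axis j 1 :: real^'n)"
    define v where "v = s *\<^sub>R (axis i 1 :: real^'n)"
    have u: "norm u \<le> s + h" and v: "norm v \<le> s"
      using bound[of s h] \<open>0 < s\<close> \<open>0 < h\<close> by (simp_all add: u_def v_def)
    have "?L u - ?L v = h * ?L (axis j 1)"
      using linear_add[OF lin] linear_cmul[OF lin] by (simp add: u_def v_def)
    then have eq: "?L u - ?L v = h * pd j (pd i f) x"
      by (simp add: pd_frechet[OF dp])
    have "norm u < d" "norm v < d"
      using u v h \<open>0 < s\<close> \<open>s < h\<close> by linarith+
    then have "\<bar>pd i f (x + u) - pd i f x - ?L u\<bar> \<le> (e / 4) * norm u"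
      "\<bar>pd i f (x + v) - pd i f x - ?L v\<bar> \<le> (e / 4) * norm v"
      using d[of "x + u"] d[of "x + v"] by simp_all
    moreover have "(e / 4) * norm u \<le> (e / 4) * (s + h)" "(e / 4) * norm v \<le> (e / 4) * s"
      using u v \<open>e > 0\<close> by (simp_all add: mult_left_mono)
    ultimately have "\<bar>pd i f (x + u) - pd i f (x + v) - h * pd j (pd i f) x\<bar> \<le> (e / 4) * (s + h) + (e/4) * s"
      using eq by linarith
    also have "\<dots> < e * h"
      using \<open>s < h\<close> \<open>e > 0\<close> \<open>0 < h\<close> by (simp add: field_simps)
    finally have "\<bar>pd i f (x + u) - pd i f (x + v) - h * pd j (pd i f) x\<bar> / h < e"
      using \<open>0 < h\<close> by (simp add: field_simps)
    moreover have "(h * (pd i f (x + u) - pd i f (x + v))) / h\<^sup>2 - pd j (pd i f) x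
        = (pd i f (x + u) - pd i f (x + v) - h * pd j (pd i f) x) / h"
      using \<open>0 < h\<close> by (simp add: field_simps power2_eq_square)
    ultimately show "dist ((f (x + h *\<^sub>R axis i 1 + h *\<^sub>R axis j 1) - f (x + h *\<^sub>R axis i 1)
      - f (x + h *\<^sub>R axis j 1) + f x) / h\<^sup>2) (pd j (pd i f) x) < e"
      using \<open>0 < h\<close> unfolding s dist_real_def by (simp add: u_def v_def add.assoc)
  qed
qed

text \<open>Young's form of the symmetry of second derivatives: the second difference quotient is
  symmetric in the two directions, and both mixed derivatives are its limit.\<close>

lemma pd_commute:
  fixes f :: "real^'n \<Rightarrow> real"
  assumes "open U" "x \<in> U" "\<And>y. y \<in> U \<Longrightarrow> f differentiable (at y)"
    and "pd i f differentiable (at x)" "pd j f differentiable (at x)"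
  shows "pd j (pd i f) x = pd i (pd j f) x"
proof (rule tendsto_unique[OF _ second_difference_tendsto[OF assms(1-3) assms(4)]])
  show "((\<lambda>h. (f (x + h *\<^sub>R axis i 1 + h *\<^sub>R axis j 1) - f (x + h *\<^sub>R axis i 1)
      - f (x + h *\<^sub>R axis j 1) + f x) / h\<^sup>2) \<longlongrightarrow> pd i (pd j f) x) (at_right 0)"
    using second_difference_tendsto[OF assms(1-3) assms(5), of i] by (simp add: algebra_simps)
qed simp

lemma smooth_on_differentiable:
  assumes "smooth_on U f" "x \<in> U"
  shows "f differentiable (at x)"
  using assms(1)[unfolded smooth_on_def, THEN spec, of "Suc 0"] assms(2) by simp

text \<open>Where \<^term>\<open>f\<close> is differentiable, \<^term>\<open>pd i f\<close> is a directional value of its Frechet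
  derivative, but elsewhere the two may differ. Smoothness of the one on an open set has to be
  carried over to the other.\<close>

lemma higher_differentiable_on_cong:
  assumes "open U" "\<And>y. y \<in> U \<Longrightarrow> f y = g y" "higher_differentiable_on U f k"
  shows "higher_differentiable_on U g k"
  using assms(2,3)
proof (induction k arbitrary: f g)
  case 0
  have "continuous_on U f"
    using "0.prems"(2) by simp
  from continuous_on_eq[OF this "0.prems"(1)] show ?case
    by simp
next
  case (Suc k)
  have df: "f differentiable (at y)" if "y \<in> U" for y
    using Suc.prems(2) that by simp
  have "g differentiable (at y)" if "y \<in> U" for y
    by (rule differentiable_cong_open[OF df[OF that] \<open>open U\<close> that Suc.prems(1)])
  moreover have "higher_differentiable_on U (\<lambda>x. frechet_derivative g (at x) v) k" for v
  proof (rule Suc.IH)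
    show "higher_differentiable_on U (\<lambda>x. frechet_derivative f (at x) v) k"
      using Suc.prems(2) by simp
    show "frechet_derivative f (at y) v = frechet_derivative g (at y) v" if "y \<in> U" for y
      using frechet_derivative_transform_within_open[OF df[OF that] \<open>open U\<close> that Suc.prems(1)]
      by simp
  qed
  ultimately show ?case by simp
qed

lemma smooth_on_pd:
  assumes "open U" "smooth_on U f"
  shows "smooth_on U (pd i f)"
  unfolding smooth_on_def
proof
  fix k
  have "higher_differentiable_on U f (Suc k)"
    using assms(2) by (simp add: smooth_on_def del: higher_differentiable_on.simps)
  then have "higher_differentiable_on U (\<lambda>x. frechet_derivative f (at x) (axis i 1)) k"
    by simp
  then show "higher_differentiable_on U (pd i f) k"
    by (rule higher_differentiable_on_cong[OF \<open>open U\<close>, rotated])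
       (simp add: pd_frechet smooth_on_differentiable[OF assms(2)])
qed

section \<open>Inverse matrices\<close>

lemma matrix_inv_mult:
  fixes A :: "real^'n^'n"
  assumes "invertible A"
  shows "A ** matrix_inv A = mat 1" "matrix_inv A ** A = mat 1"
  using someI_ex[OF assms[unfolded invertible_def]] by (simp_all add: matrix_inv_def)

lemma matrix_inv_unique:
  fixes A :: "real^'n^'n"
  assumes "A ** B = mat 1"
  shows "matrix_inv A = B"
proof -
  have "invertible A"
    using assms invertible_right_inverse by blast
  then have "matrix_inv A ** (A ** B) = B"
    by (simp add: matrix_mul_assoc matrix_inv_mult)
  then show ?thesis
    by (simp add: assms)
qed

text \<open>Differentiating \<open>g\<^sup>-\<^sup>1 g = 1\<close> entrywise gives \<open>\<partial>(g\<^sup>-\<^sup>1) g + g\<^sup>-\<^sup>1 \<partial>g = 0\<close>.\<close>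

lemma pd_mat_inverse:
  fixes g :: "real^'n \<Rightarrow> real^'n^'n"
  assumes "open U" "x \<in> U" and inv: "\<And>y. y \<in> U \<Longrightarrow> invertible (g y)"
    and dg: "\<And>a b. (\<lambda>y. g y $ a $ b) differentiable (at x)"
    and dk: "\<And>a b. (\<lambda>y. matrix_inv (g y) $ a $ b) differentiable (at x)"
  shows "pd_mat i (\<lambda>y. matrix_inv (g y)) x = - (matrix_inv (g x) ** pd_mat i g x ** matrix_inv (g x))"
proof -
  let ?k = "\<lambda>y. matrix_inv (g y)"
  have "pd_mat i ?k x ** g x + ?k x ** pd_mat i g x = 0"
  proof (simp add: vec_eq_iff matrix_matrix_mult_def pd_mat_def, intro allI)
    fix a b
    have "0 = pd i (\<lambda>y. \<Sum>c\<in>UNIV. ?k y $ a $ c * g y $ c $ b) x"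
    proof -
      have "(\<Sum>c\<in>UNIV. ?k y $ a $ c * g y $ c $ b) = (mat 1 :: real^'n^'n) $ a $ b" if "y \<in> U" for y
        unfolding matrix_inv_mult(2)[OF inv[OF that], symmetric] by (simp add: matrix_matrix_mult_def)
      from pd_cong_open[OF assms(1,2) this] show ?thesis
        by simp
    qed
    also have "\<dots> = (\<Sum>c\<in>UNIV. pd i (\<lambda>y. ?k y $ a $ c) x * g x $ c $ b)
        + (\<Sum>c\<in>UNIV. ?k x $ a $ c * pd i (\<lambda>y. g y $ c $ b) x)"
      by (subst pd_sum) (auto simp: pd_mult dg dk sum.distrib)
    finally show "(\<Sum>c\<in>UNIV. pd i (\<lambda>y. ?k y $ a $ c) x * g x $ c $ b)
        + (\<Sum>c\<in>UNIV. ?k x $ a $ c * pd i (\<lambda>y. g y $ c $ b) x) = 0" by simp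
  qed
  then have "(pd_mat i ?k x ** g x + ?k x ** pd_mat i g x) ** ?k x = 0"
    by simp
  then have "pd_mat i ?k x ** (g x ** ?k x) + ?k x ** pd_mat i g x ** ?k x = 0"
    by (simp add: matrix_mul_assoc)
       (simp add: vec_eq_iff matrix_matrix_mult_def distrib_right sum.distrib)
  then show ?thesis
    using matrix_inv_mult(1)[OF inv[OF \<open>x \<in> U\<close>]] by (simp add: eq_neg_iff_add_eq_0)
qed

section \<open>Scalar curvature of a Hessian metric with trace-free cubic form\<close>

text \<open>Write \<open>T\<^sub>c\<^sub>a\<^sub>b = \<partial>\<^sub>c g\<^sub>a\<^sub>b\<close>. The Codazzi hypothesis makes \<open>T\<close> totally symmetric (locally, \<open>g\<close> is
  the Hessian of a function), and so the three terms of the Christoffel symbol collapse to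
  \<open>\<Gamma>\<^sup>l\<^sub>m\<^sub>n = g\<^sup>l\<^sup>s T\<^sub>s\<^sub>m\<^sub>n / 2\<close>. The last hypothesis, that \<open>T\<close> is trace-free, holds by Jacobi's formula
  when \<open>det g\<close> is constant. It kills both contractions \<open>\<Gamma>\<^sup>r\<^sub>r\<^sub>s\<close> and \<open>g\<^sup>s\<^sup>n \<Gamma>\<^sup>r\<^sub>s\<^sub>n\<close>.
  The first removes two of the four terms of the Ricci tensor. The second, differentiated, trades
  the remaining derivative term \<open>g\<^sup>s\<^sup>n \<partial>\<^sub>r \<Gamma>\<^sup>r\<^sub>s\<^sub>n\<close> for \<open>- (\<partial>\<^sub>r g\<^sup>s\<^sup>n) \<Gamma>\<^sup>r\<^sub>s\<^sub>n\<close>, so the curvature contains no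
  derivatives of \<open>g\<close> beyond the first: with \<open>|T|\<^sup>2\<close> the square norm of \<open>T\<close> in the metric \<open>g\<close>, the
  derivative term contributes \<open>|T|\<^sup>2 / 2\<close> and the quadratic term \<open>- |T|\<^sup>2 / 4\<close>. The right-hand side
  is \<open>|T|\<^sup>2 / 4\<close> as well, because \<open>\<partial>\<^sub>a (g\<^sup>-\<^sup>1) = - g\<^sup>-\<^sup>1 T\<^sub>a g\<^sup>-\<^sup>1\<close>.\<close>

lemma ricci_scalar_hessian_metric:
  fixes g :: "real^'n \<Rightarrow> real^'n^'n"
  assumes "open U" "x \<in> U"
    and sym: "\<And>y a b. y \<in> U \<Longrightarrow> g y $ a $ b = g y $ b $ a"
    and inv: "\<And>y. y \<in> U \<Longrightarrow> invertible (g y)"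
    and dg: "\<And>y a b. y \<in> U \<Longrightarrow> (\<lambda>y. g y $ a $ b) differentiable (at y)"
    and dk: "\<And>y a b. y \<in> U \<Longrightarrow> (\<lambda>y. matrix_inv (g y) $ a $ b) differentiable (at y)"
    and ddg: "\<And>y a b c. y \<in> U \<Longrightarrow> pd c (\<lambda>y. g y $ a $ b) differentiable (at y)"
    and codazzi: "\<And>y a b c. y \<in> U \<Longrightarrow> pd c (\<lambda>y. g y $ a $ b) y = pd a (\<lambda>y. g y $ c $ b) y"
    and apolar: "\<And>y c. y \<in> U \<Longrightarrow> trace (matrix_inv (g y) ** pd_mat c g y) = 0"
  shows "ricci_scalar g x = - 1/4 * (\<Sum>a\<in>UNIV. \<Sum>b\<in>UNIV. matrix_inv (g x) $ a $ b *
           trace (pd_mat a (\<lambda>y. matrix_inv (g y)) x ** pd_mat b g x))"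
proof -
  define k where "k = (\<lambda>y. matrix_inv (g y))"
  define T where "T = (\<lambda>c a b y. pd c (\<lambda>y. g y $ a $ b) y)"
  define G where "G = christoffel g"
  have T23: "T c a b y = T c b a y" if "y \<in> U" for c a b y
    unfolding T_def using sym by (intro pd_cong_open[OF \<open>open U\<close> that]) auto
  have T12: "T c a b y = T a c b y" if "y \<in> U" for c a b y
    unfolding T_def by (rule codazzi[OF that])
  have T_eq: "pd c (\<lambda>y. g y $ a $ b) y = T c a b y" for c a b y
    by (simp add: T_def)
  have G_eq: "G l m n y = 1/2 * (\<Sum>s\<in>UNIV. k y $ l $ s * T s m n y)" if "y \<in> U" for l m n y
  proof -
    have 1: "T m s n y = T s m n y" for s
      by (rule T12[OF that])
    have 2: "T n s m y = T s m n y" for s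
      using T12[OF that, of n s m] T23[OF that, of s n m] by simp
    show ?thesis
      unfolding G_def christoffel_def T_eq 1 2 by (simp add: k_def)
  qed
  have G_sym: "G l m n y = G l n m y" if "y \<in> U" for l m n y
    using T23[OF that] by (simp add: G_eq[OF that])
  have apolar': "(\<Sum>a\<in>UNIV. \<Sum>b\<in>UNIV. k y $ a $ b * T c a b y) = 0" if "y \<in> U" for c y
  proof -
    have "(\<Sum>a\<in>UNIV. \<Sum>b\<in>UNIV. k y $ a $ b * T c b a y) = 0"
      using apolar[OF that, of c]
      by (simp add: trace_def matrix_matrix_mult_def pd_mat_def k_def T_def)
    then show ?thesis using T23[OF that] by (simp cong: sum.cong)
  qed
  have G_trace: "(\<Sum>r\<in>UNIV. G r r s y) = 0" if "y \<in> U" for s y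
  proof -
    have "T a r s y = T s r a y" for a r
      using T12[OF that, of a r s] T23[OF that, of r a s] T12[OF that, of r s a] by simp
    then show ?thesis
      using apolar'[OF that, of s] T23[OF that] by (simp add: G_eq[OF that] flip: sum_divide_distrib)
  qed
  have G_harm: "(\<Sum>s\<in>UNIV. \<Sum>n\<in>UNIV. k y $ s $ n * G r n s y) = 0" if "y \<in> U" for r y
  proof -
    have "(\<Sum>s\<in>UNIV. \<Sum>n\<in>UNIV. k y $ s $ n * G r n s y)
        = 1/2 * (\<Sum>s\<in>UNIV. \<Sum>n\<in>UNIV. \<Sum>a\<in>UNIV. k y $ r $ a * (k y $ s $ n * T a s n y))"
      using T23[OF that] by (simp add: G_eq[OF that] sum_distrib_left mult_ac)
    also have "\<dots> = 1/2 * (\<Sum>a\<in>UNIV. \<Sum>s\<in>UNIV. \<Sum>n\<in>UNIV. k y $ r $ a * (k y $ s $ n * T a s n y))"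
      by (subst (2) sum.swap, subst (3) sum.swap, rule refl)
    also have "\<dots> = 0"
      using apolar'[OF that] by (simp flip: sum_distrib_left)
    finally show ?thesis .
  qed
  have dG: "G l m n differentiable (at x)" for l m n
  proof (rule differentiable_cong_open[OF _ \<open>open U\<close> \<open>x \<in> U\<close>])
    show "(\<lambda>y. 1/2 * (\<Sum>s\<in>UNIV. k y $ l $ s * T s m n y)) differentiable (at x)"
      unfolding k_def T_def
      by (intro differentiable_mult differentiable_const differentiable_sum ballI dk
          ddg[unfolded eta_contract_eq] \<open>x \<in> U\<close>) simp_all
  qed (simp add: G_eq)
  define K where "K = matrix_inv (g x)"
  define D where "D = (\<lambda>m. pd_mat m g x)"
  \<comment> \<open>the square norm of the cubic form \<^term>\<open>T\<close> at \<^term>\<open>x\<close>, in matrix notation\<close>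
  define Q where "Q = (\<Sum>a\<in>UNIV. \<Sum>b\<in>UNIV. K $ a $ b * trace (K ** D a ** K ** D b))"
  have D_nth: "D m $ a $ b = T m a b x" for m a b
    by (simp add: D_def pd_mat_def T_def)
  have K_nth: "K $ a $ b = k x $ a $ b" for a b
    by (simp add: K_def k_def)
  have GD: "G l m n x = 1/2 * (K ** D m) $ l $ n" for l m n
    using T12[OF \<open>x \<in> U\<close>] by (simp add: G_eq[OF \<open>x \<in> U\<close>] matrix_matrix_mult_def D_nth K_nth)
  have dK: "pd_mat m k x = - (K ** D m ** K)" for m
    unfolding k_def K_def D_def
    by (rule pd_mat_inverse[OF \<open>open U\<close> \<open>x \<in> U\<close> inv dg[OF \<open>x \<in> U\<close>] dk[OF \<open>x \<in> U\<close>]])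
  have pd_zero: "pd m f x = 0" if "\<And>y. y \<in> U \<Longrightarrow> f y = 0" for m f
    using pd_cong_open[OF \<open>open U\<close> \<open>x \<in> U\<close>, of f "\<lambda>y. 0" m] that by simp
  have ricci_eq: "ricci g s n x =
      (\<Sum>r\<in>UNIV. pd r (G r n s) x) - 1/4 * trace (K ** D n ** K ** D s)" for s n
  proof -
    have 1: "(\<Sum>r\<in>UNIV. pd n (G r r s) x) = 0"
      using pd_zero[of "\<lambda>y. \<Sum>r\<in>UNIV. G r r s y" n, OF G_trace] by (simp add: pd_sum dG)
    have 2: "(\<Sum>r\<in>UNIV. \<Sum>l\<in>UNIV. G r r l x * G l n s x) = 0"
      by (subst sum.swap) (simp add: G_trace[OF \<open>x \<in> U\<close>] flip: sum_distrib_right)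
    have "(\<Sum>r\<in>UNIV. \<Sum>l\<in>UNIV. G r n l x * G l r s x)
        = (\<Sum>r\<in>UNIV. \<Sum>l\<in>UNIV. G r n l x * G l s r x)"
      by (intro sum.cong refl arg_cong2[where f = "(*)"] G_sym[OF \<open>x \<in> U\<close>])
    also have "\<dots> = 1/4 * trace ((K ** D n) ** (K ** D s))"
      by (simp add: GD trace_def matrix_matrix_mult_def[of "K ** D n"] sum_distrib_left)
    finally have 3: "(\<Sum>r\<in>UNIV. \<Sum>l\<in>UNIV. G r n l x * G l r s x)
        = 1/4 * trace (K ** D n ** K ** D s)"
      by (simp add: matrix_mul_assoc)
    show ?thesis
      unfolding ricci_def riemann_def G_def[symmetric] sum.distrib sum_subtractf 1 2 3 by simp
  qed
  \<comment> \<open>the product rule applied to the vanishing contraction of \<^term>\<open>G r\<close> with the inverse metric\<close>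
  have div: "(\<Sum>s\<in>UNIV. \<Sum>n\<in>UNIV. K $ s $ n * pd r (G r n s) x)
      = 1/2 * (\<Sum>a\<in>UNIV. K $ r $ a * trace (K ** D r ** K ** D a))" for r
  proof -
    have "0 = pd r (\<lambda>y. \<Sum>s\<in>UNIV. \<Sum>n\<in>UNIV. k y $ s $ n * G r n s y) x"
      by (rule pd_zero[OF G_harm, symmetric])
    also have "\<dots> = (\<Sum>s\<in>UNIV. \<Sum>n\<in>UNIV. pd_mat r k x $ s $ n * G r n s x)
        + (\<Sum>s\<in>UNIV. \<Sum>n\<in>UNIV. K $ s $ n * pd r (G r n s) x)"
      using dk[OF \<open>x \<in> U\<close>]
      by (simp add: pd_sum pd_mult dG sum.distrib pd_mat_def K_def k_def)
    also have "(\<Sum>s\<in>UNIV. \<Sum>n\<in>UNIV. pd_mat r k x $ s $ n * G r n s x)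
        = - (\<Sum>s\<in>UNIV. \<Sum>n\<in>UNIV. \<Sum>a\<in>UNIV. 1/2 * (K $ r $ a * ((K ** D r ** K) $ s $ n * D a $ n $ s)))"
      by (simp add: dK G_eq[OF \<open>x \<in> U\<close>] D_nth K_nth sum_distrib_left sum_negf mult_ac)
    also have "\<dots> = - (\<Sum>a\<in>UNIV. \<Sum>s\<in>UNIV. \<Sum>n\<in>UNIV. 1/2 * (K $ r $ a * ((K ** D r ** K) $ s $ n * D a $ n $ s)))"
      by (subst (2) sum.swap, subst (3) sum.swap, rule refl)
    also have "\<dots> = - (1/2 * (\<Sum>a\<in>UNIV. K $ r $ a * trace (K ** D r ** K ** D a)))"
      by (simp add: trace_def matrix_matrix_mult_def[of "K ** D r ** K"] sum_distrib_left)
    finally show ?thesis by simp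
  qed
  have "ricci_scalar g x = (\<Sum>s\<in>UNIV. \<Sum>n\<in>UNIV. K $ s $ n * (\<Sum>r\<in>UNIV. pd r (G r n s) x))
      - (\<Sum>s\<in>UNIV. \<Sum>n\<in>UNIV. K $ s $ n * (1/4 * trace (K ** D n ** K ** D s)))"
    by (simp add: ricci_scalar_def ricci_eq K_def[symmetric] right_diff_distrib sum_subtractf)
  also have "(\<Sum>s\<in>UNIV. \<Sum>n\<in>UNIV. K $ s $ n * (\<Sum>r\<in>UNIV. pd r (G r n s) x))
      = (\<Sum>s\<in>UNIV. \<Sum>n\<in>UNIV. \<Sum>r\<in>UNIV. K $ s $ n * pd r (G r n s) x)"
    by (simp add: sum_distrib_left)
  also have "\<dots> = (\<Sum>r\<in>UNIV. \<Sum>s\<in>UNIV. \<Sum>n\<in>UNIV. K $ s $ n * pd r (G r n s) x)"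
    by (subst (2) sum.swap, subst sum.swap, rule refl)
  also have "\<dots> = 1/2 * Q"
    by (simp add: div Q_def sum_distrib_left)
  also have "(\<Sum>s\<in>UNIV. \<Sum>n\<in>UNIV. K $ s $ n * (1/4 * trace (K ** D n ** K ** D s))) = 1/4 * Q"
  proof -
    have "trace (K ** D n ** K ** D s) = trace (K ** D s ** K ** D n)" for n s
      using trace_mul_sym[of "K ** D n" "K ** D s"] by (simp add: matrix_mul_assoc)
    then show ?thesis by (simp add: Q_def sum_distrib_left mult_ac)
  qed
  finally have "ricci_scalar g x = 1/4 * Q" by simp
  moreover have "(\<Sum>a\<in>UNIV. \<Sum>b\<in>UNIV. K $ a $ b * trace (pd_mat a k x ** D b)) = - Q"
  proof -
    have "trace (pd_mat a k x ** D b) = - trace (K ** D a ** K ** D b)" for a b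
      by (simp add: dK trace_def matrix_matrix_mult_def[of "- (K ** D a ** K)"]
          matrix_matrix_mult_def[of "K ** D a ** K"] sum_negf)
    then show ?thesis by (simp add: Q_def sum_negf)
  qed
  ultimately show ?thesis
    by (simp add: K_def D_def k_def)
qed

section \<open>Two-dimensional metrics with constant determinant\<close>

lemma matrix_inv_2:
  fixes A :: "real^2^2"
  assumes "det A \<noteq> 0"
  shows "matrix_inv A $ 1 $ 1 = A $ 2 $ 2 / det A" "matrix_inv A $ 1 $ 2 = - A $ 1 $ 2 / det A"
    "matrix_inv A $ 2 $ 1 = - A $ 2 $ 1 / det A" "matrix_inv A $ 2 $ 2 = A $ 1 $ 1 / det A"
proof -
  define B :: "real^2^2" where
    "B = vector [vector [A $ 2 $ 2 / det A, - A $ 1 $ 2 / det A],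
                 vector [- A $ 2 $ 1 / det A, A $ 1 $ 1 / det A]]"
  have B: "B $ 1 $ 1 = A $ 2 $ 2 / det A" "B $ 1 $ 2 = - A $ 1 $ 2 / det A"
    "B $ 2 $ 1 = - A $ 2 $ 1 / det A" "B $ 2 $ 2 = A $ 1 $ 1 / det A"
    by (simp_all add: B_def)
  have "(A ** B) $ i $ j = (mat 1 :: real^2^2) $ i $ j" for i j
    using assms exhaust_2[of i] exhaust_2[of j]
    by (auto simp: matrix_matrix_mult_def sum_2 B mat_def diff_divide_distrib[symmetric])
       (simp_all add: det_2 mult.commute)
  then have "matrix_inv A = B"
    by (intro matrix_inv_unique) (simp add: vec_eq_iff)
  then show "matrix_inv A $ 1 $ 1 = A $ 2 $ 2 / det A" "matrix_inv A $ 1 $ 2 = - A $ 1 $ 2 / det A"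
    "matrix_inv A $ 2 $ 1 = - A $ 2 $ 1 / det A" "matrix_inv A $ 2 $ 2 = A $ 1 $ 1 / det A"
    by (simp_all add: B)
qed

text \<open>Jacobi's formula: a constant determinant makes \<open>g\<^sup>-\<^sup>1 \<partial>g\<close> trace-free.\<close>

lemma pd_det_2:
  fixes g :: "real^'n \<Rightarrow> real^2^2"
  assumes "det (g x) \<noteq> 0" "\<And>a b. (\<lambda>y. g y $ a $ b) differentiable (at x)"
  shows "pd c (\<lambda>y. det (g y)) x = det (g x) * trace (matrix_inv (g x) ** pd_mat c g x)"
proof -
  have "((\<lambda>t. det (g (x + t *\<^sub>R axis c 1))) has_real_derivative
      g x $ 2 $ 2 * pd c (\<lambda>y. g y $ 1 $ 1) x - g x $ 1 $ 2 * pd c (\<lambda>y. g y $ 2 $ 1) x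
      - g x $ 2 $ 1 * pd c (\<lambda>y. g y $ 1 $ 2) x + g x $ 1 $ 1 * pd c (\<lambda>y. g y $ 2 $ 2) x) (at 0)"
    unfolding det_2 by (rule derivative_eq_intros DERIV_pd[OF assms(2)] refl | simp add: algebra_simps)+
  then have "pd c (\<lambda>y. det (g y)) x =
      g x $ 2 $ 2 * pd c (\<lambda>y. g y $ 1 $ 1) x - g x $ 1 $ 2 * pd c (\<lambda>y. g y $ 2 $ 1) x
      - g x $ 2 $ 1 * pd c (\<lambda>y. g y $ 1 $ 2) x + g x $ 1 $ 1 * pd c (\<lambda>y. g y $ 2 $ 2) x"
    by (rule pd_eqI)
  moreover have "trace (matrix_inv (g x) ** pd_mat c g x) =
      (g x $ 2 $ 2 * pd c (\<lambda>y. g y $ 1 $ 1) x - g x $ 1 $ 2 * pd c (\<lambda>y. g y $ 2 $ 1) x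
      - g x $ 2 $ 1 * pd c (\<lambda>y. g y $ 1 $ 2) x + g x $ 1 $ 1 * pd c (\<lambda>y. g y $ 2 $ 2) x) / det (g x)"
    using assms(1) by (simp add: trace_def matrix_matrix_mult_def sum_2 matrix_inv_2 pd_mat_def
        add_divide_distrib diff_divide_distrib)
  ultimately show ?thesis
    using assms(1) by simp
qed

text \<open>In dimension two, the entries of \<open>g\<^sup>-\<^sup>1\<close> are up to sign those of \<open>g\<close> divided by the constant
  determinant, hence differentiable, and total symmetry of \<open>\<partial>g\<close> reduces to one pair of derivative
  directions.\<close>

lemma ricci_scalar_hessian_metric_2:
  fixes g :: "real^2 \<Rightarrow> real^2^2"
  assumes "open U" "x \<in> U" "D \<noteq> 0"
    and det: "\<And>y. y \<in> U \<Longrightarrow> det (g y) = D"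
    and sym: "\<And>y a b. y \<in> U \<Longrightarrow> g y $ a $ b = g y $ b $ a"
    and dg: "\<And>y a b. y \<in> U \<Longrightarrow> (\<lambda>y. g y $ a $ b) differentiable (at y)"
    and ddg: "\<And>y a b c. y \<in> U \<Longrightarrow> pd c (\<lambda>y. g y $ a $ b) differentiable (at y)"
    and codazzi: "\<And>y b. y \<in> U \<Longrightarrow> pd 2 (\<lambda>y. g y $ 1 $ b) y = pd 1 (\<lambda>y. g y $ 2 $ b) y"
  shows "ricci_scalar g x = - 1/4 * (\<Sum>a\<in>UNIV. \<Sum>b\<in>UNIV. matrix_inv (g x) $ a $ b *
           trace (pd_mat a (\<lambda>y. matrix_inv (g y)) x ** pd_mat b g x))"
proof (rule ricci_scalar_hessian_metric[OF assms(1,2) sym _ dg _ ddg])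
  fix y :: "real^2" and a b c :: 2
  assume y: "y \<in> U"
  show "invertible (g y)"
    using det[OF y] \<open>D \<noteq> 0\<close> by (simp add: invertible_det_nz)
  have "(\<lambda>z. g z $ 2 $ 2 / D) differentiable (at y)" "(\<lambda>z. - g z $ 1 $ 2 / D) differentiable (at y)"
    "(\<lambda>z. - g z $ 2 $ 1 / D) differentiable (at y)" "(\<lambda>z. g z $ 1 $ 1 / D) differentiable (at y)"
    using dg[OF y] \<open>D \<noteq> 0\<close> by simp_all
  note d = this[THEN differentiable_cong_open[OF _ \<open>open U\<close> y]]
  have "(\<lambda>z. matrix_inv (g z) $ 1 $ 1) differentiable (at y)"
    "(\<lambda>z. matrix_inv (g z) $ 1 $ 2) differentiable (at y)"
    "(\<lambda>z. matrix_inv (g z) $ 2 $ 1) differentiable (at y)"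
    "(\<lambda>z. matrix_inv (g z) $ 2 $ 2) differentiable (at y)"
    using \<open>D \<noteq> 0\<close> by - (rule d(1) d(2) d(3) d(4), simp add: matrix_inv_2 det)+
  then show "(\<lambda>z. matrix_inv (g z) $ a $ b) differentiable (at y)"
    using exhaust_2[of a] exhaust_2[of b] by auto
  show "pd c (\<lambda>y. g y $ a $ b) y = pd a (\<lambda>y. g y $ c $ b) y"
    using exhaust_2[of a] exhaust_2[of c] codazzi[OF y] by auto
  have "pd c (\<lambda>y. det (g y)) y = pd c (\<lambda>y. D) y"
    by (rule pd_cong_open[OF \<open>open U\<close> y]) (rule det)
  then show "trace (matrix_inv (g y) ** pd_mat c g y) = 0"
    using pd_det_2[of g y c] dg[OF y] det[OF y] \<open>D \<noteq> 0\<close> by simp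
qed

section \<open>Minimal graphs\<close>

text \<open>Here \<open>A, B, C\<close> are the entries of \<open>g\<^sub>0\<close>, \<open>p, q\<close> and \<open>r, s, t\<close> the first and second derivatives
  of \<open>\<phi>\<close>, and \<open>\<rho>1, \<rho>2\<close> the first derivatives of \<open>\<rho>\<close>. Both sides of each identity are
  \<open>\<rho>\<^sup>3\<^sup>/\<^sup>2 \<partial>\<^sub>c (h\<^sub>a\<^sub>b / \<surd>\<rho>)\<close>, with \<open>c\<close> exchanged with \<open>a\<close>. Once the denominators are cleared, the
  difference of the two sides is a multiple of the minimal surface expression.\<close>

lemma minimal_graph_codazzi_identities:
  fixes A B C e p q r s t \<rho> \<rho>1 \<rho>2 :: real
  assumes D: "D = A * C - B\<^sup>2" "D \<noteq> 0"
    and rho: "\<rho> = 1 + e * (C * p\<^sup>2 - 2 * B * p * q + A * q\<^sup>2) / D"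
    and rho1: "\<rho>1 = 2 * e * (C * p * r - B * (r * q + p * s) + A * q * s) / D"
    and rho2: "\<rho>2 = 2 * e * (C * p * s - B * (s * q + p * t) + A * q * t) / D"
    and minimal: "(C + e * q\<^sup>2) * r - 2 * (B + e * p * q) * s + (A + e * p\<^sup>2) * t = 0"
  shows "- (1/2) * \<rho>2 * (A + e * p\<^sup>2) + \<rho> * (e * (s * p + p * s))
       = - (1/2) * \<rho>1 * (B + e * p * q) + \<rho> * (e * (r * q + p * s))"
    and "- (1/2) * \<rho>2 * (B + e * p * q) + \<rho> * (e * (s * q + p * t))
       = - (1/2) * \<rho>1 * (C + e * q\<^sup>2) + \<rho> * (e * (s * q + q * s))"
proof -
  let ?P = "D + e * (C * p\<^sup>2 - 2 * B * p * q + A * q\<^sup>2)"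
  let ?M = "(C + e * q\<^sup>2) * r - 2 * (B + e * p * q) * s + (A + e * p\<^sup>2) * t"
  let ?R1 = "C * p * r - B * (r * q + p * s) + A * q * s"
  let ?R2 = "C * p * s - B * (s * q + p * t) + A * q * t"
  have clear: "\<rho> = ?P / D" "\<rho>1 = 2 * e * ?R1 / D" "\<rho>2 = 2 * e * ?R2 / D"
    using D(2) by (simp_all add: rho rho1 rho2 add_divide_distrib)
  \<comment> \<open>The cofactors \<open>B p - A q\<close> here and \<open>C p - B q\<close> below are found by comparing the coefficients of
     \<open>r\<close> and \<open>t\<close>, respectively.\<close>
  have "?P * (p * s - r * q) - ?R2 * (A + e * p\<^sup>2) + ?R1 * (B + e * p * q) = (B * p - A * q) * ?M"
    unfolding D(1) by algebra
  then have "e * (- ?R2 * (A + e * p\<^sup>2) + ?P * (s * p + p * s))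
       = e * (- ?R1 * (B + e * p * q) + ?P * (r * q + p * s))"
    unfolding minimal by algebra
  then show "- (1/2) * \<rho>2 * (A + e * p\<^sup>2) + \<rho> * (e * (s * p + p * s))
       = - (1/2) * \<rho>1 * (B + e * p * q) + \<rho> * (e * (r * q + p * s))"
    unfolding clear using D(2) by (simp add: divide_simps) algebra
  have "?P * (p * t - s * q) - ?R2 * (B + e * p * q) + ?R1 * (C + e * q\<^sup>2) = (C * p - B * q) * ?M"
    unfolding D(1) by algebra
  then have "e * (- ?R2 * (B + e * p * q) + ?P * (s * q + p * t))
       = e * (- ?R1 * (C + e * q\<^sup>2) + ?P * (s * q + q * s))"
    unfolding minimal by algebra
  then show "- (1/2) * \<rho>2 * (B + e * p * q) + \<rho> * (e * (s * q + p * t))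
       = - (1/2) * \<rho>1 * (C + e * q\<^sup>2) + \<rho> * (e * (s * q + q * s))"
    unfolding clear using D(2) by (simp add: divide_simps) algebra
qed

theorem proposition1:
  fixes \<epsilon> :: real and g0 :: "real^2^2" and \<phi> :: "real^2 \<Rightarrow> real" and U :: "(real^2) set"
    and g :: "real^2 \<Rightarrow> real^2^2"
  assumes "\<epsilon> \<in> {1, -1}"
    and "transpose g0 = g0" and "invertible g0"
    and "open U" and "smooth_on U \<phi>"
    and "\<forall>x\<in>U. rho \<epsilon> g0 \<phi> x > 0"
    and "minimal_graph_on U \<epsilon> g0 \<phi>"
  defines "g \<equiv> conformal_metric \<epsilon> g0 \<phi>"
  shows "\<forall>x\<in>U. ricci_scalar g x =
    - 1/4 * (\<Sum>\<alpha>\<in>UNIV. \<Sum>\<beta>\<in>UNIV. matrix_inv (g x) $ \<alpha> $ \<beta> *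
               trace (pd_mat \<alpha> (\<lambda>y. matrix_inv (g y)) x ** pd_mat \<beta> g x))"
proof
  fix x assume "x \<in> U"
  define D where "D = det g0"
  define r where "r = rho \<epsilon> g0 \<phi>"
  define h where "h = induced_metric \<epsilon> g0 \<phi>"
  define p where "p = (\<lambda>m. pd m \<phi>)"
  define w where "w = (\<lambda>y. 1 / sqrt (r y))"
  have "D \<noteq> 0"
    using \<open>invertible g0\<close> by (simp add: D_def invertible_det_nz)
  have g0_sym: "g0 $ a $ b = g0 $ b $ a" for a b
    by (subst \<open>transpose g0 = g0\<close>[symmetric]) (simp add: transpose_def)
  have D_eq: "D = g0 $ 1 $ 1 * g0 $ 2 $ 2 - (g0 $ 1 $ 2)\<^sup>2"
    using g0_sym[of 2 1] by (simp add: D_def det_2 power2_eq_square)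
  have r_pos: "r y > 0" if "y \<in> U" for y
    using assms(6) that by (simp add: r_def)
  have w_r: "w y = w y ^ 3 * r y" "w y \<noteq> 0" if "y \<in> U" for y
    using r_pos[OF that] by (auto simp: w_def power3_eq_cube)
  have g_eq: "g y $ a $ b = w y * h y $ a $ b" for y a b
    by (simp add: g_def conformal_metric_def w_def r_def h_def)
  have h_eq: "h y $ a $ b = g0 $ a $ b + \<epsilon> * p a y * p b y" for y a b
    by (simp add: h_def induced_metric_def p_def)
  have h_sym: "h y $ a $ b = h y $ b $ a" for y a b
    using g0_sym[of a b] by (simp add: h_eq)
  have r_sum: "r y = 1 + \<epsilon> * (\<Sum>m\<in>UNIV. \<Sum>n\<in>UNIV. matrix_inv g0 $ m $ n * (p m y * p n y))" for y
    by (simp add: r_def rho_def p_def mult.assoc)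

  have smooth_p: "smooth_on U (p m)" and smooth_dp: "smooth_on U (pd c (p m))" for m c
    unfolding p_def by (intro smooth_on_pd \<open>open U\<close> \<open>smooth_on U \<phi>\<close>)+
  have d\<phi>: "\<phi> differentiable (at y)" and dp: "p m differentiable (at y)"
    and ddp: "pd c (p m) differentiable (at y)" if "y \<in> U" for y m c
    using smooth_on_differentiable that \<open>smooth_on U \<phi>\<close> smooth_p smooth_dp by blast+
  have p_sym: "pd c (p m) y = pd m (p c) y" if "y \<in> U" for c m y
    unfolding p_def using pd_commute[OF \<open>open U\<close> that d\<phi>] dp[OF that] by (simp add: p_def)

  have dr: "r differentiable (at y)" if "y \<in> U" for y
    unfolding r_sum[abs_def] using dp[OF that]
    by (intro differentiable_add differentiable_mult differentiable_const differentiable_sum) simp_all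
  have pd_r: "pd c r y = \<epsilon> * (\<Sum>m\<in>UNIV. \<Sum>n\<in>UNIV. matrix_inv g0 $ m $ n *
      (pd c (p m) y * p n y + p m y * pd c (p n) y))" if "y \<in> U" for c y
    unfolding r_sum[abs_def] using dp[OF that] by (simp add: pd_add pd_mult pd_sum)
  have ddr: "pd c r differentiable (at y)" if "y \<in> U" for c y
  proof (rule differentiable_cong_open[OF _ \<open>open U\<close> that pd_r[symmetric]])
    show "(\<lambda>y. \<epsilon> * (\<Sum>m\<in>UNIV. \<Sum>n\<in>UNIV. matrix_inv g0 $ m $ n *
      (pd c (p m) y * p n y + p m y * pd c (p n) y))) differentiable (at y)"
      using dp[OF that] ddp[OF that] by simp
  qed
  have dw: "w differentiable (at y)" and pd_w: "pd c w y = - (1/2) * w y ^ 3 * pd c r y"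
    if "y \<in> U" for c y
    unfolding w_def using dr[OF that] r_pos[OF that]
    by (auto intro: differentiable_inverse_sqrt simp: pd_inverse_sqrt)
  have dh: "(\<lambda>y. h y $ a $ b) differentiable (at y)" if "y \<in> U" for a b y
    unfolding h_eq using dp[OF that] by simp
  have pd_h: "pd c (\<lambda>y. h y $ a $ b) y = \<epsilon> * (pd c (p a) y * p b y + p a y * pd c (p b) y)"
    if "y \<in> U" for a b c y
    unfolding h_eq using dp[OF that] by (simp add: pd_add pd_mult algebra_simps)
  have dg: "(\<lambda>y. g y $ a $ b) differentiable (at y)" if "y \<in> U" for a b y
    unfolding g_eq using dw[OF that] dh[OF that] by simp
  have pd_g: "pd c (\<lambda>y. g y $ a $ b) y = w y ^ 3 * (- (1/2) * pd c r y * h y $ a $ b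
      + r y * (\<epsilon> * (pd c (p a) y * p b y + p a y * pd c (p b) y)))" (is "_ = ?rhs y")
    if "y \<in> U" for a b c y
  proof -
    have "pd c (\<lambda>y. g y $ a $ b) y = - (1/2) * w y ^ 3 * pd c r y * h y $ a $ b
        + w y * (\<epsilon> * (pd c (p a) y * p b y + p a y * pd c (p b) y))"
      unfolding g_eq using dw[OF that] dh[OF that] by (simp add: pd_mult pd_w[OF that] pd_h[OF that])
    \<comment> \<open>\<open>w = w\<^sup>3 \<rho>\<close> lets both summands share the factor \<open>w\<^sup>3\<close>, which then drops out of the Codazzi
       equations\<close>
    also have "\<dots> = ?rhs y"
      by (subst (2) w_r(1)[OF that]) (simp add: algebra_simps)
    finally show ?thesis .
  qed
  have ddg: "pd c (\<lambda>y. g y $ a $ b) differentiable (at y)" if "y \<in> U" for a b c y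
  proof (rule differentiable_cong_open[OF _ \<open>open U\<close> that pd_g[symmetric]])
    show "(\<lambda>y. w y ^ 3 * (- (1/2) * pd c r y * h y $ a $ b
      + r y * (\<epsilon> * (pd c (p a) y * p b y + p a y * pd c (p b) y)))) differentiable (at y)"
      using dw[OF that] ddr[OF that] dh[OF that] dr[OF that] dp[OF that] ddp[OF that] by simp
  qed

  have r_eq: "r y = 1 + \<epsilon> * (g0 $ 2 $ 2 * (p 1 y)\<^sup>2 - 2 * g0 $ 1 $ 2 * p 1 y * p 2 y
      + g0 $ 1 $ 1 * (p 2 y)\<^sup>2) / D" for y
    using \<open>D \<noteq> 0\<close> g0_sym[of 2 1]
    by (simp add: r_sum sum_2 matrix_inv_2 D_def field_simps power2_eq_square)
  have pd_r_eq: "pd c r y = 2 * \<epsilon> * (g0 $ 2 $ 2 * p 1 y * pd c (p 1) y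
      - g0 $ 1 $ 2 * (pd c (p 1) y * p 2 y + p 1 y * pd c (p 2) y)
      + g0 $ 1 $ 1 * p 2 y * pd c (p 2) y) / D" if "y \<in> U" for c y
    using \<open>D \<noteq> 0\<close> g0_sym[of 2 1]
    by (simp add: pd_r[OF that] sum_2 matrix_inv_2 D_def field_simps)
  have det_h: "det (h y) = r y * D" for y
  proof -
    have "r y * D = D + \<epsilon> * (g0 $ 2 $ 2 * (p 1 y)\<^sup>2 - 2 * g0 $ 1 $ 2 * p 1 y * p 2 y
      + g0 $ 1 $ 1 * (p 2 y)\<^sup>2)"
      using \<open>D \<noteq> 0\<close> by (simp add: r_eq distrib_right)
    then show ?thesis
      using g0_sym[of 2 1] by (simp add: D_eq det_2 h_eq algebra_simps power2_eq_square)
  qed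
  have det_g: "det (g y) = D" if "y \<in> U" for y
  proof -
    have "det (g y) = w y ^ 2 * det (h y)"
      by (simp add: det_2 g_eq algebra_simps power2_eq_square)
    also have "\<dots> = D"
      using r_pos[OF that] by (simp add: det_h w_def power_divide)
    finally show ?thesis .
  qed
  have minimal: "(g0 $ 2 $ 2 + \<epsilon> * (p 2 y)\<^sup>2) * pd 1 (p 1) y
      - 2 * (g0 $ 1 $ 2 + \<epsilon> * p 1 y * p 2 y) * pd 1 (p 2) y
      + (g0 $ 1 $ 1 + \<epsilon> * (p 1 y)\<^sup>2) * pd 2 (p 2) y = 0" if "y \<in> U" for y
  proof -
    have nz: "det (h y) \<noteq> 0"
      using r_pos[OF that] \<open>D \<noteq> 0\<close> by (simp add: det_h)
    have "0 = mean_curvature \<epsilon> g0 \<phi> y"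
      using assms(7) that by (simp add: minimal_graph_on_def)
    also have "\<dots> = w y * ((h y $ 2 $ 2 * pd 1 (p 1) y - h y $ 1 $ 2 * pd 2 (p 1) y
        - h y $ 2 $ 1 * pd 1 (p 2) y + h y $ 1 $ 1 * pd 2 (p 2) y) / det (h y))"
      using nz by (simp add: mean_curvature_def w_def r_def p_def sum_2 matrix_inv_2 add_divide_distrib
          diff_divide_distrib flip: h_def)
    finally have "h y $ 2 $ 2 * pd 1 (p 1) y - h y $ 1 $ 2 * pd 2 (p 1) y
        - h y $ 2 $ 1 * pd 1 (p 2) y + h y $ 1 $ 1 * pd 2 (p 2) y = 0"
      using w_r(2)[OF that] nz by simp
    then show ?thesis
      using p_sym[OF that, of 2 1] h_sym[of y 2 1] by (simp add: h_eq power2_eq_square algebra_simps)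
  qed
  have codazzi: "pd 2 (\<lambda>y. g y $ 1 $ b) y = pd 1 (\<lambda>y. g y $ 2 $ b) y" if y: "y \<in> U" for b y
  proof -
    note sym = p_sym[OF y, of 2 1] h_sym[of y 2 1] g0_sym[of 2 1]
    note identities = minimal_graph_codazzi_identities[OF D_eq \<open>D \<noteq> 0\<close> r_eq[of y]
        _ _ minimal[OF y], of "pd 1 r y" "pd 2 r y"]
    have "- (1/2) * pd 2 r y * h y $ 1 $ 1 + r y * (\<epsilon> * (pd 2 (p 1) y * p 1 y + p 1 y * pd 2 (p 1) y))
      = - (1/2) * pd 1 r y * h y $ 2 $ 1 + r y * (\<epsilon> * (pd 1 (p 2) y * p 1 y + p 2 y * pd 1 (p 1) y))"
      using identities(1) sym by (simp add: pd_r_eq[OF y] h_eq power2_eq_square algebra_simps)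
    moreover have "- (1/2) * pd 2 r y * h y $ 1 $ 2 + r y * (\<epsilon> * (pd 2 (p 1) y * p 2 y + p 1 y * pd 2 (p 2) y))
      = - (1/2) * pd 1 r y * h y $ 2 $ 2 + r y * (\<epsilon> * (pd 1 (p 2) y * p 2 y + p 2 y * pd 1 (p 2) y))"
      using identities(2) sym by (simp add: pd_r_eq[OF y] h_eq power2_eq_square algebra_simps)
    ultimately show ?thesis
      using exhaust_2[of b] by (auto simp only: pd_g[OF y])
  qed
  have g_sym: "g y $ a $ b = g y $ b $ a" if "y \<in> U" for y a b
    using h_sym[of y a b] by (simp add: g_eq)
  show "ricci_scalar g x =
    - 1/4 * (\<Sum>\<alpha>\<in>UNIV. \<Sum>\<beta>\<in>UNIV. matrix_inv (g x) $ \<alpha> $ \<beta> *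
               trace (pd_mat \<alpha> (\<lambda>y. matrix_inv (g y)) x ** pd_mat \<beta> g x))"
    by (rule ricci_scalar_hessian_metric_2[OF \<open>open U\<close> \<open>x \<in> U\<close> \<open>D \<noteq> 0\<close> det_g g_sym dg ddg codazzi])
qed

end
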